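(* Consider the reverse (procurement) auction with one buyer (the radiometer) and sellers $\mathcal N=\{1,\dots,N\}$, $N\ge 1$, with buyer valuation $v_0$, feasible family $\mathcal A\subseteq 2^\Omega$, and private seller costs $C_i(\cdot;\theta_i)$, $\theta_i\in\Theta_i$, as defined in the context. Assume that for every seller $i$ the restricted feasible family $\mathcal A_{-i}=\{S\in\mathcal A : S\cap\Omega_i=\emptyset\}$ is non-empty. Consider the direct revelation mechanism that, given a report profile $\hat\theta=(\hat\theta_1,\dots,\hat\theta_N)\in\prod_i\Theta_i$ with reported costs $\hat C_i=C_i(\cdot;\hat\theta_i)$, selects an allocation $$S^*(\hat\theta)\in\arg\max_{S\in\mathcal A}\Big(v_0(S)-\sum_{i=1}^N\hat C_i(S_i)\Big),\qquad S_i=S\cap\Omega_i,$$ and pays each seller $i$ $$p_i(\hat\theta)=\hat C_i(S_i^* )+\big(W(S^*;\hat\theta)-W_{-i}(\hat\theta_{-i})\big),$$ where $S^*=S^*(\hat\theta)$, $S^*_i=S^*\cap\Omega_i$, $W(S;\hat\theta)=v_0(S)-\sum_{j=1}^N\hat C_j(S_j)$ and $W_{-i}(\hat\theta_{-i})=\max_{S'\in\mathcal A_{-i}}\big[v_0(S')-\sum_{j\ne i}\hat C_j(S'_j)\big]$. A seller $i$ with true type $\theta_i$ has utility $u_i(\hat\theta;\theta_i)=p_i(\hat\theta)-C_i(S_i^*(\hat\theta);\theta_i)$. Then: 1. (Dominant-strategy incentive compatibility) For every seller $i$, every true type $\theta_i\in\Theta_i$, every report $\hat\theta_i\in\Theta_i$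 and every profile $\hat\theta_{-i}$ of reports of the other sellers, $u_i((\theta_i,\hat\theta_{-i});\theta_i)\ge u_i((\hat\theta_i,\hat\theta_{-i});\theta_i)$. 2. (Allocative efficiency) When all sellers report truthfully, i.e. $\hat\theta=\theta$, the selected allocation $S^*(\theta)$ maximizes the true social welfare $W(S;\theta)=v_0(S)-\sum_{i=1}^N C_i(S_i;\theta_i)$ over all $S\subseteq\Omega$. 3. (Individual rationality) For every report profile $\hat\theta$ and every seller $i$, the payment covers at least the reported cost, $p_i(\hat\theta)\ge\hat C_i(S_i^*(\hat\theta))$; in particular a truthfully reporting seller has utility $u_i((\theta_i,\hat\theta_{-i});\theta_i)\ge 0$.
   Context: Physical model. $\Omega$ is a finite set of tiles; each tile $x\in\Omega$ has a channel $j(x)\in\{1,\dots,J\}$, duration $\delta t_x\in(0,\tau]$, bandwidth $\delta f_x>0$ and duty cycle $\alpha_x\in[0,1]$, where $\tau>0$ is the integration window. An allocation is a subset $S\subseteq\Omega$ (the tiles designated as quiet). The effective clean bandwidth of channel $j$ is $$B_j(S)=B_j^{(0)}+\frac1\tau\sum_{x\in S,\ j(x)=j}\alpha_x\,\delta t_x\,\delta f_x,\qquad B_j^{(0)}>0.$$ For products $k=1,\dots,K$ with real coefficients $c_{k,j}$, constants $\kappa_j>0$ and fixed residual interference penalties $\phi_j\ge 0$ (the value $\phi_j(M_j)$ for the fixed interference mask $M_j$), the retrieval variance is $$\mathrm{Var}[\hat y_k](S)=\sum_{j=1}^J c_{k,j}^2\Big(\frac{\kappa_j}{B_j(S)\,\tau}+\phi_j\Big).$$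 Given accuracy thresholds $\varepsilon_k>0$, the family of feasible allocations is $\mathcal A=\{S\subseteq\Omega:\mathrm{Var}[\hat y_k](S)\le\varepsilon_k^2\ \text{for all }k\}$. Buyer valuation. With a scaling factor $\lambda_0>0$ and weights $w_k>0$, $v_0:2^\Omega\to\mathbb R\cup\{-\infty\}$ is $v_0(S)=\lambda_0\sum_{k=1}^K w_k(\varepsilon_k^2-\mathrm{Var}[\hat y_k](S))$ if $S\in\mathcal A$, and $v_0(S)=-\infty$ otherwise. Sellers. $\Omega$ is partitioned as $\Omega=\bigsqcup_{i=1}^N\Omega_i$, where $\Omega_i$ is the set of tiles controlled by seller $i$; for $S\subseteq\Omega$ write $S_i=S\cap\Omega_i$. Seller $i$ has a private type $\theta_i$ in a type set $\Theta_i$ and an associated real-valued cost function $C_i(\cdot;\theta_i):2^{\Omega_i}\to\mathbb R$ that is non-decreasing with respect to inclusion and satisfies $C_i(\emptyset;\theta_i)=0$. Reports range over $\Theta_i$, so reported cost functions have the same properties. Ties in the allocation rule are resolved by an arbitrary fixed selection $\hat\theta\mapsto S^*(\hat\theta)$. *)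

theory Defs
  imports "HOL-Library.Extended_Real" "HOL-Library.FuncSet" "HOL-Library.Disjoint_Sets"
begin


text \<open>Channels, products and sellers are indexed by \<open>{1..J}\<close>, \<open>{1..K}\<close> and \<open>{1..N}\<close>.\<close>

record 'x radiometer =
  tiles :: "'x set"                    (* Omega *)
  nchan :: nat                         (* J *)
  chan :: "'x \<Rightarrow> nat"                  (* j(x) *)
  duration :: "'x \<Rightarrow> real"             (* delta t_x *)
  bandwidth :: "'x \<Rightarrow> real"            (* delta f_x *)
  duty :: "'x \<Rightarrow> real"                 (* alpha_x *)
  window :: real                       (* tau *)
  base_bw :: "nat \<Rightarrow> real"             (* B_j^(0) *)
  nprod :: nat                         (* K *)
  coef :: "nat \<Rightarrow> nat \<Rightarrow> real"         (* c_{k,j} *)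
  kappa :: "nat \<Rightarrow> real"               (* kappa_j *)
  penalty :: "nat \<Rightarrow> real"             (* phi_j *)
  threshold :: "nat \<Rightarrow> real"           (* epsilon_k *)
  scale :: real                        (* lambda_0 *)
  weight :: "nat \<Rightarrow> real"              (* w_k *)

locale radiometer =
  fixes R :: "('x, 'm) radiometer_scheme" (structure)
  assumes finite_tiles: "finite (tiles R)"
    and chan_range: "x \<in> tiles R \<Longrightarrow> chan R x \<in> {1..nchan R}"
    and duration_range: "x \<in> tiles R \<Longrightarrow> duration R x \<in> {0<..window R}"
    and bandwidth_pos: "x \<in> tiles R \<Longrightarrow> 0 < bandwidth R x"
    and duty_range: "x \<in> tiles R \<Longrightarrow> duty R x \<in> {0..1}"
    and window_pos: "0 < window R"
    and base_bw_pos: "j \<in> {1..nchan R} \<Longrightarrow> 0 < base_bw R j"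
    and kappa_pos: "j \<in> {1..nchan R} \<Longrightarrow> 0 < kappa R j"
    and penalty_nonneg: "j \<in> {1..nchan R} \<Longrightarrow> 0 \<le> penalty R j"
    and threshold_pos: "k \<in> {1..nprod R} \<Longrightarrow> 0 < threshold R k"
    and scale_pos: "0 < scale R"
    and weight_pos: "k \<in> {1..nprod R} \<Longrightarrow> 0 < weight R k"

definition clean_bw :: "('x, 'm) radiometer_scheme \<Rightarrow> nat \<Rightarrow> 'x set \<Rightarrow> real" where
  "clean_bw R j S =
     base_bw R j + (1 / window R) * (\<Sum>x\<in>{x \<in> S. chan R x = j}. duty R x * duration R x * bandwidth R x)"

definition retrieval_var :: "('x, 'm) radiometer_scheme \<Rightarrow> nat \<Rightarrow> 'x set \<Rightarrow> real" where
  "retrieval_var R k S =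
     (\<Sum>j = 1..nchan R. (coef R k j)\<^sup>2 * (kappa R j / (clean_bw R j S * window R) + penalty R j))"

definition feasible :: "('x, 'm) radiometer_scheme \<Rightarrow> 'x set set" where
  "feasible R =
     {S. S \<subseteq> tiles R \<and> (\<forall>k\<in>{1..nprod R}. retrieval_var R k S \<le> (threshold R k)\<^sup>2)}"

definition buyer_value :: "('x, 'm) radiometer_scheme \<Rightarrow> 'x set \<Rightarrow> ereal" where
  "buyer_value R S =
     (if S \<in> feasible R
      then ereal (scale R * (\<Sum>k = 1..nprod R. weight R k * ((threshold R k)\<^sup>2 - retrieval_var R k S)))
      else - \<infinity>)"



text \<open>The type sets \<open>\<Theta>\<^sub>i\<close> of the sellers are arbitrary subsets of one common type \<open>'t\<close>.
  The cost \<open>cost A i t\<close> is only constrained, and only ever used, on subsets of \<open>\<Omega>\<^sub>i\<close>.\<close>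

record ('x, 't) auction = "'x radiometer" +
  nseller :: nat                               (* N *)
  owned :: "nat \<Rightarrow> 'x set"                     (* Omega_i *)
  types :: "nat \<Rightarrow> 't set"                     (* Theta_i *)
  cost :: "nat \<Rightarrow> 't \<Rightarrow> 'x set \<Rightarrow> real"         (* C_i(S; theta_i) *)

locale auction = radiometer A for A :: "('x, 't, 'm) auction_scheme" (structure) +
  assumes nseller_pos: "1 \<le> nseller A"
    and owned_disjoint: "disjoint_family_on (owned A) {1..nseller A}"
    and owned_cover: "(\<Union>i\<in>{1..nseller A}. owned A i) = tiles A"
    and cost_mono: "\<lbrakk>i \<in> {1..nseller A}; t \<in> types A i\<rbrakk> \<Longrightarrow> mono_on (Pow (owned A i)) (cost A i t)"
    and cost_empty: "\<lbrakk>i \<in> {1..nseller A}; t \<in> types A i\<rbrakk> \<Longrightarrow> cost A i t {} = 0"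

definition profiles :: "('x, 't, 'm) auction_scheme \<Rightarrow> (nat \<Rightarrow> 't) set" where
  "profiles A = PiE {1..nseller A} (types A)"

definition profiles_without :: "('x, 't, 'm) auction_scheme \<Rightarrow> nat \<Rightarrow> (nat \<Rightarrow> 't) set" where
  "profiles_without A i = PiE ({1..nseller A} - {i}) (types A)"

definition feasible_without :: "('x, 't, 'm) auction_scheme \<Rightarrow> nat \<Rightarrow> 'x set set" where
  "feasible_without A i = {S \<in> feasible A. S \<inter> owned A i = {}}"

definition welfare :: "('x, 't, 'm) auction_scheme \<Rightarrow> (nat \<Rightarrow> 't) \<Rightarrow> 'x set \<Rightarrow> ereal" where
  "welfare A r S =
     buyer_value A S - ereal (\<Sum>i = 1..nseller A. cost A i (r i) (S \<inter> owned A i))"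

definition welfare_without :: "('x, 't, 'm) auction_scheme \<Rightarrow> nat \<Rightarrow> (nat \<Rightarrow> 't) \<Rightarrow> ereal" where
  "welfare_without A i r =
     Max ((\<lambda>S. buyer_value A S - ereal (\<Sum>j\<in>{1..nseller A} - {i}. cost A j (r j) (S \<inter> owned A j)))
            ` feasible_without A i)"

text \<open>\<open>sel\<close> is the allocation rule \<open>S\<^sup>*\<close>. The conversion to a real number loses nothing:
  both welfare terms are finite, see \<open>ereal_payment\<close> below.\<close>

definition payment ::
  "('x, 't, 'm) auction_scheme \<Rightarrow> ((nat \<Rightarrow> 't) \<Rightarrow> 'x set) \<Rightarrow> (nat \<Rightarrow> 't) \<Rightarrow> nat \<Rightarrow> real" where
  "payment A sel r i =
     cost A i (r i) (sel r \<inter> owned A i)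
     + real_of_ereal (welfare A r (sel r) - welfare_without A i r)"

definition utility ::
  "('x, 't, 'm) auction_scheme \<Rightarrow> ((nat \<Rightarrow> 't) \<Rightarrow> 'x set) \<Rightarrow> (nat \<Rightarrow> 't) \<Rightarrow> nat \<Rightarrow> 't \<Rightarrow> real" where
  "utility A sel r i t = payment A sel r i - cost A i t (sel r \<inter> owned A i)"

lemma (in auction) ereal_payment:
  assumes "sel r \<in> feasible A" and "feasible_without A i \<noteq> {}"
  shows "\<bar>welfare A r (sel r)\<bar> \<noteq> \<infinity>"
    and "\<bar>welfare_without A i r\<bar> \<noteq> \<infinity>"
    and "ereal (payment A sel r i) =
           ereal (cost A i (r i) (sel r \<inter> owned A i))
           + (welfare A r (sel r) - welfare_without A i r)"
proof -
  show w: "\<bar>welfare A r (sel r)\<bar> \<noteq> \<infinity>"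
    using assms(1) by (simp add: welfare_def buyer_value_def)
  have "finite (feasible_without A i)"
    by (rule finite_subset[of _ "Pow (tiles A)"])
       (auto simp: feasible_without_def feasible_def finite_tiles)
  then have "welfare_without A i r \<in>
      (\<lambda>S. buyer_value A S - ereal (\<Sum>j\<in>{1..nseller A} - {i}. cost A j (r j) (S \<inter> owned A j)))
        ` feasible_without A i"
    unfolding welfare_without_def using assms(2) by (intro Max_in) auto
  then show w': "\<bar>welfare_without A i r\<bar> \<noteq> \<infinity>"
    by (auto simp: buyer_value_def feasible_without_def)
  from w w' show "ereal (payment A sel r i) =
      ereal (cost A i (r i) (sel r \<inter> owned A i))
      + (welfare A r (sel r) - welfare_without A i r)"
    by (cases "welfare A r (sel r)"; cases "welfare_without A i r") (auto simp: payment_def)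
qed

end

theory Submission
  imports Defs
begin

text \<open>
  The Vickrey-Clarke-Groves argument: whatever the reports, the utility of seller \<open>i\<close> is the
  welfare of the selected allocation, evaluated with \<open>i\<close>'s true cost, minus a term independent of
  \<open>i\<close>'s report. The allocation rule maximizes the former when \<open>i\<close> is truthful, and the maximum is at
  least the latter because an allocation that avoids \<open>\<Omega>\<^sub>i\<close> costs \<open>i\<close> nothing.
\<close>

text \<open>Only the summand of seller \<open>i\<close> depends on \<open>r i\<close>. The
  correction is a real number, so the identity survives where the buyer's value is
  -\<infinity>.\<close>

lemma welfare_fun_upd:
  assumes "i \<in> {1..nseller A}"
  shows "welfare A (r(i := t)) S =
    welfare A r S + ereal (cost A i (r i) (S \<inter> owned A i) - cost A i t (S \<inter> owned A i))"
proof -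
  have "(\<Sum>j = 1..nseller A. cost A j ((r(i := t)) j) (S \<inter> owned A j)) =
      (\<Sum>j = 1..nseller A. cost A j (r j) (S \<inter> owned A j))
      - cost A i (r i) (S \<inter> owned A i) + cost A i t (S \<inter> owned A i)"
    by (simp add: sum.remove[OF finite_atLeastAtMost assms] del: One_nat_def)
  then show ?thesis
    by (cases "buyer_value A S") (auto simp: welfare_def)
qed

lemma welfare_without_fun_upd [simp]: "welfare_without A i (r(i := t)) = welfare_without A i r"
  by (simp add: welfare_without_def)

text \<open>The reimbursed reported cost cancels against the one inside the welfare, leaving the
  cost under \<open>t\<close> in its place. The subtracted pivot term does not see
  \<open>r i\<close>.\<close>

lemma (in auction) ereal_utility:
  assumes "i \<in> {1..nseller A}" "sel r \<in> feasible A" "feasible_without A i \<noteq> {}"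
  shows "ereal (utility A sel r i t) = welfare A (r(i := t)) (sel r) - welfare_without A i r"
  using ereal_payment[where sel = sel and r = r, OF assms(2,3)]
  unfolding utility_def welfare_fun_upd[OF assms(1)]
  by (cases "welfare A r (sel r)"; cases "welfare_without A i r") auto

lemma (in auction) welfare_without_le:
  assumes "i \<in> {1..nseller A}" "r i \<in> types A i" "feasible_without A i \<noteq> {}"
    and max: "is_arg_max (welfare A r) (\<lambda>S. S \<in> feasible A) T"
  shows "welfare_without A i r \<le> welfare A r T"
proof -
  have "buyer_value A S - ereal (\<Sum>j\<in>{1..nseller A} - {i}. cost A j (r j) (S \<inter> owned A j))
      \<le> welfare A r T" if "S \<in> feasible_without A i" for S
  proof -
    from that have "S \<in> feasible A" and disj: "S \<inter> owned A i = {}"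
      by (auto simp: feasible_without_def)
    then have "welfare A r S \<le> welfare A r T"
      using max by (auto simp: is_arg_max_linorder)
    \<comment> \<open>Here the summand of \<open>i\<close> is the cost of \<open>{}\<close>, which
      vanishes for an admissible report by \<open>cost_empty\<close>.\<close>
    moreover have "welfare A r S =
        buyer_value A S - ereal (\<Sum>j\<in>{1..nseller A} - {i}. cost A j (r j) (S \<inter> owned A j))"
      using assms(1,2) disj
      by (simp add: welfare_def sum.remove[OF finite_atLeastAtMost assms(1)] cost_empty del: One_nat_def)
    ultimately show ?thesis by simp
  qed
  moreover have "finite (feasible_without A i)"
    by (rule finite_subset[of _ "Pow (tiles A)"])
       (auto simp: feasible_without_def feasible_def finite_tiles)
  ultimately show ?thesis
    using assms(3) by (simp add: welfare_without_def)
qed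

text \<open>An infeasible set has welfare -\<infinity>, since only a real cost is subtracted from
  -\<infinity>; it can never beat \<open>T\<close>.\<close>

lemma is_arg_max_welfare_subset:
  assumes max: "is_arg_max (welfare A r) (\<lambda>S. S \<in> feasible A) T"
  shows "is_arg_max (welfare A r) (\<lambda>S. S \<subseteq> tiles A) T"
proof -
  have "welfare A r S \<le> welfare A r T" for S
  proof (cases "S \<in> feasible A")
    case True
    then show ?thesis using max by (auto simp: is_arg_max_linorder)
  next
    case False
    then show ?thesis by (simp add: welfare_def buyer_value_def)
  qed
  moreover have "T \<subseteq> tiles A"
    using max by (auto simp: is_arg_max_linorder feasible_def)
  ultimately show ?thesis
    by (auto simp: is_arg_max_linorder)
qed

theorem mainTheorem1:
  fixes A :: "('x, 't) auction" and sel :: "(nat \<Rightarrow> 't) \<Rightarrow> 'x set"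
  assumes "auction A"
    and "\<And>i. i \<in> {1..nseller A} \<Longrightarrow> feasible_without A i \<noteq> {}"
    and "\<And>r. r \<in> profiles A \<Longrightarrow> is_arg_max (welfare A r) (\<lambda>S. S \<in> feasible A) (sel r)"
  shows "(\<forall>i\<in>{1..nseller A}. \<forall>t\<in>types A i. \<forall>t'\<in>types A i. \<forall>r\<in>profiles_without A i.
            utility A sel (r(i := t)) i t \<ge> utility A sel (r(i := t')) i t)
       \<and> (\<forall>r\<in>profiles A. is_arg_max (welfare A r) (\<lambda>S. S \<subseteq> tiles A) (sel r))
       \<and> (\<forall>r\<in>profiles A. \<forall>i\<in>{1..nseller A}.
            payment A sel r i \<ge> cost A i (r i) (sel r \<inter> owned A i))
       \<and> (\<forall>i\<in>{1..nseller A}. \<forall>t\<in>types A i. \<forall>r\<in>profiles_without A i.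
            utility A sel (r(i := t)) i t \<ge> 0)"
proof -
  interpret auction A by fact
  have feas: "sel r \<in> feasible A" if "r \<in> profiles A" for r
    using assms(3)[OF that] by (simp add: is_arg_max_linorder)
  \<comment> \<open>Profiles of the others are \<open>undefined\<close> at \<open>i\<close>; filling
    that slot gives a full extensional profile.\<close>
  have upd: "r(i := t) \<in> profiles A"
    if "i \<in> {1..nseller A}" "t \<in> types A i" "r \<in> profiles_without A i" for i t r
    using that by (auto simp: profiles_def profiles_without_def PiE_iff extensional_def)
  have dsic: "utility A sel (r(i := t)) i t \<ge> utility A sel (r(i := t')) i t"
    if i: "i \<in> {1..nseller A}" and t: "t \<in> types A i" "t' \<in> types A i"
      and r: "r \<in> profiles_without A i" for i t t' r
  proof -
    \<comment> \<open>The allocation obtained by misreporting is one feasible competitor in the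
      maximization under the truthful report.\<close>
    have "welfare A (r(i := t)) (sel (r(i := t'))) \<le> welfare A (r(i := t)) (sel (r(i := t)))"
      using assms(3)[OF upd[OF i t(1) r]] feas[OF upd[OF i t(2) r]]
      by (auto simp: is_arg_max_linorder)
    \<comment> \<open>The update by the true type overwrites \<open>t'\<close>, so both utilities
      use the welfare of \<open>r(i := t)\<close> and the same pivot term.\<close>
    then have "ereal (utility A sel (r(i := t')) i t) \<le> ereal (utility A sel (r(i := t)) i t)"
      using ereal_utility[where sel = sel, OF i feas[OF upd[OF i t(1) r]] assms(2)[OF i]]
        ereal_utility[where sel = sel, OF i feas[OF upd[OF i t(2) r]] assms(2)[OF i]]
      by (simp add: ereal_minus_mono)
    then show ?thesis by simp
  qed
  have pay: "payment A sel r i \<ge> cost A i (r i) (sel r \<inter> owned A i)"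
    if r: "r \<in> profiles A" and i: "i \<in> {1..nseller A}" for r i
  proof -
    have "r i \<in> types A i"
      using r i by (auto simp: profiles_def)
    then have "welfare_without A i r \<le> welfare A r (sel r)"
      by (rule welfare_without_le[OF i _ assms(2)[OF i] assms(3)[OF r]])
    then have "0 \<le> real_of_ereal (welfare A r (sel r) - welfare_without A i r)"
      using ereal_payment(1,2)[where sel = sel, OF feas[OF r] assms(2)[OF i]]
      by (cases "welfare A r (sel r)"; cases "welfare_without A i r") auto
    then show ?thesis by (simp add: payment_def)
  qed
  have ir: "utility A sel (r(i := t)) i t \<ge> 0"
    if "i \<in> {1..nseller A}" "t \<in> types A i" "r \<in> profiles_without A i" for i t r
    \<comment> \<open>Under truth-telling the reported cost that the payment covers is the true
      cost.\<close>
    using pay[OF upd[OF that] that(1)] by (simp add: utility_def)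
  show ?thesis
    using dsic is_arg_max_welfare_subset[OF assms(3)] pay ir by blast
qed

end
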